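(* Assume that $\mathbf{r}=(r_0,r_1)\in\mathbb{R}^2$ is contained in one of the following sets: (i) $\{(r_0,r_1)\in\mathbb{R}^2 \mid r_0>0,\ r_1\le -2\sqrt{r_0},\ r_0+r_1\ge 0\}$; (ii) $\{(r_0,r_1)\in\mathbb{R}^2 \mid r_0+r_1\le -2,\ r_0-r_1\ne -1\}\setminus\{(r_0,r_1)\in\mathbb{R}^2 \mid r_0>-2,\ r_1>-1\}$; (iii) $\{(r_0,r_1)\in\mathbb{R}^2 \mid r_0+r_1\ge 0,\ r_0<0,\ r_1\ge 1\}$. Then $\mathbf{r}\in\mathcal{D}_2^{( * )}$.
   Context: For $\mathbf{r}=(r_0,r_1)\in\mathbb{R}^2$, the two-dimensional shift radix system is the map $\tau_{\mathbf{r}}:\mathbb{Z}^2\to\mathbb{Z}^2$, $\tau_{\mathbf{r}}(a_0,a_1)=(a_1,-\lfloor r_0a_0+r_1a_1\rfloor)$. The orbit of $(a_0,a_1)$ is identified with the integer sequence $(a_n)_{n\ge 0}$ where $a_{n+2}=-\lfloor r_0a_n+r_1a_{n+1}\rfloor$ for $n\ge0$. An orbit is ultimately periodic if there are $n_0\ge 0$, $p>0$ with $a_{n+p}=a_n$ for all $n\ge n_0$; it ends up in the trivial cycle if $a_n=0$ for all sufficiently large $n$. $\mathcal{D}_2^{( * )}$ is the set of all $\mathbf{r}\in\mathbb{R}^2$ such that each ultimately periodic orbit of $\tau_{\mathbf{r}}$ ends up in the trivial cycle. *)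

theory Defs
  imports Complex_Main
begin

definition srs_tau :: "real \<times> real \<Rightarrow> int \<times> int \<Rightarrow> int \<times> int" where
  "srs_tau r a = (snd a, - \<lfloor>fst r * of_int (fst a) + snd r * of_int (snd a)\<rfloor>)"

text \<open>The orbit of \<open>a\<close>, identified with the integer sequence of first components;
  the second component of the \<open>n\<close>-th iterate is the sequence element \<open>n + 1\<close>.\<close>
definition srs_orbit :: "real \<times> real \<Rightarrow> int \<times> int \<Rightarrow> nat \<Rightarrow> int" where
  "srs_orbit r a n = fst ((srs_tau r ^^ n) a)"

lemma srs_orbit_0: "srs_orbit r a 0 = fst a"
  by (simp add: srs_orbit_def)

lemma snd_srs_tau_funpow: "snd ((srs_tau r ^^ n) a) = srs_orbit r a (Suc n)"
  by (simp add: srs_orbit_def srs_tau_def)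

lemma srs_orbit_1: "srs_orbit r a 1 = snd a"
  by (simp add: srs_orbit_def srs_tau_def)

lemma srs_orbit_rec:
  "srs_orbit r a (n + 2) =
     - \<lfloor>fst r * of_int (srs_orbit r a n) + snd r * of_int (srs_orbit r a (n + 1))\<rfloor>"
  by (simp add: srs_orbit_def srs_tau_def)

definition ultimately_periodic :: "(nat \<Rightarrow> int) \<Rightarrow> bool" where
  "ultimately_periodic a \<longleftrightarrow> (\<exists>n0 p. p > 0 \<and> (\<forall>n\<ge>n0. a (n + p) = a n))"

definition ends_in_trivial_cycle :: "(nat \<Rightarrow> int) \<Rightarrow> bool" where
  "ends_in_trivial_cycle a \<longleftrightarrow> (\<exists>n0. \<forall>n\<ge>n0. a n = 0)"

definition D2_star :: "(real \<times> real) set" where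
  "D2_star = {r. \<forall>a. ultimately_periodic (srs_orbit r a) \<longrightarrow> ends_in_trivial_cycle (srs_orbit r a)}"

end

theory Submission
  imports Defs
begin

text \<open>Writing \<open>e n = a (n + 2) + r1 * a (n + 1) + r0 * a n \<in> [0, 1)\<close>, a periodic integer
  sequence is controlled in three ways: evaluating \<open>e\<close> where the sequence attains its maximum or
  minimum, summing \<open>e\<close> over a period (which locates the mean value of \<open>a\<close> between \<open>0\<close> and
  \<open>1 / (1 + r0 + r1)\<close>), and following the sign pattern.
  In region (i) the roots \<open>l\<close>, \<open>m\<close> of \<open>x\<^sup>2 + r1 x + r0\<close> exceed 1, and the extremum argument
  applied first to \<open>a (n + 1) - m * a n\<close> and then to \<open>a\<close> gives \<open>0 \<le> a n < 1 / (1 + r0 + r1) \<le> 1\<close>.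
  In the parts of region (ii) where \<open>r0\<close> and \<open>r1\<close> are not both negative, one coefficient dominates
  the other two and the extremum argument applies to \<open>a\<close> itself. If both are negative, or in region
  (iii), a nonzero periodic sequence not excluded by its mean value or its minimum alternates in sign, and
  then integrality excludes an extremum of \<open>\<bar>a\<bar>\<close>.\<close>

section \<open>Extrema of periodic sequences\<close>

text \<open>A maximum over one period is global. Moving its position by \<open>p > 0\<close> makes
  it a successor, so that the extremal term can also serve as the middle term of the
  recurrence.\<close>

lemma periodic_attains_max:
  fixes f :: "nat \<Rightarrow> 'a :: linorder"
  assumes "p > 0" and per: "\<And>n. f (n + p) = f n"
  shows "\<exists>n. \<forall>k. f k \<le> f (Suc n)"
proof -
  have shift: "f (n + j * p) = f n" for n j
    by (induction j) (simp_all add: per add.assoc[symmetric] add.commute[of p])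
  have fin: "finite (f ` {..<p})" and ne: "f ` {..<p} \<noteq> {}"
    using \<open>p > 0\<close> by auto
  obtain n where n: "f n = Max (f ` {..<p})"
    using Max_in[OF fin ne] by auto
  have "f k \<le> f (n + p)" for k
  proof -
    have "f k = f (k mod p)"
      using shift[of "k mod p" "k div p"] by simp
    also have "\<dots> \<le> Max (f ` {..<p})"
      using fin \<open>p > 0\<close> by (intro Max_ge) auto
    finally show ?thesis
      using n per by simp
  qed
  moreover obtain m where "n + p = Suc m"
    using \<open>p > 0\<close> by (cases "n + p") auto
  ultimately show ?thesis
    by metis
qed

lemma periodic_attains_min:
  fixes f :: "nat \<Rightarrow> 'a :: linordered_idom"
  assumes "p > 0" and "\<And>n. f (n + p) = f n"
  shows "\<exists>n. \<forall>k. f (Suc n) \<le> f k"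
  using periodic_attains_max[of p "\<lambda>n. - f n"] assms by simp

section \<open>Periodic orbits and invariants of consecutive pairs\<close>

text \<open>An ultimately periodic orbit without its preperiod. The two inequalities encode the
  floor recurrence: the bounded quantity is the fractional part of
  \<open>r0 * a n + r1 * a (Suc n)\<close>.\<close>

locale periodic_srs =
  fixes r0 r1 :: real and a :: "nat \<Rightarrow> int" and p :: nat
  assumes p_pos: "p > 0"
    and per: "\<And>n. a (n + p) = a n"
    and rec_lower: "\<And>n. 0 \<le> a (Suc (Suc n)) + r1 * a (Suc n) + r0 * a n"
    and rec_upper: "\<And>n. a (Suc (Suc n)) + r1 * a (Suc n) + r0 * a n < 1"
begin

lemma max_exists:
  obtains n where "\<And>k. a k \<le> a (Suc n)"
  using periodic_attains_max[of p a] p_pos per by auto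

lemma min_exists:
  obtains n where "\<And>k. a (Suc n) \<le> a k"
  using periodic_attains_min[of p a] p_pos per by auto

lemma abs_max_exists:
  obtains n where "\<And>k. \<bar>a k\<bar> \<le> \<bar>a (Suc n)\<bar>"
  using periodic_attains_max[of p "\<lambda>n. \<bar>a n\<bar>"] p_pos per by auto

lemma abs_min_exists:
  obtains n where "\<And>k. \<bar>a (Suc n)\<bar> \<le> \<bar>a k\<bar>"
  using periodic_attains_min[of p "\<lambda>n. \<bar>a n\<bar>"] p_pos per by auto

lemma eventually_imp_always:
  assumes "\<And>k. k \<ge> n \<Longrightarrow> P (a k) (a (Suc k))"
  shows "P (a k) (a (Suc k))"
proof -
  have shift: "a (k + j * p) = a k" for k j
    by (induction j) (simp_all add: per add.assoc[symmetric] add.commute[of p])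
  have "n * 1 \<le> n * p"
    using p_pos by (intro mult_le_mono2) simp
  then have "P (a (k + n * p)) (a (Suc (k + n * p)))"
    by (intro assms) linarith
  then show ?thesis
    using shift[of k n] shift[of "Suc k" n] by simp
qed

text \<open>Forward propagation reaches all indices from \<open>n\<close> on, and periodicity
  carries the property back to the earlier ones.\<close>

lemma invariant_imp_always:
  assumes "P (a n) (a (Suc n))"
    and step: "\<And>k. P (a k) (a (Suc k)) \<Longrightarrow> P (a (Suc k)) (a (Suc (Suc k)))"
  shows "P (a k) (a (Suc k))"
proof (rule eventually_imp_always)
  fix k assume "n \<le> k"
  then show "P (a k) (a (Suc k))"
    by (induction k rule: dec_induct) (auto intro: assms)
qed

lemma zero_if_two_zeros:
  assumes "a n = 0" "a (Suc n) = 0"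
  shows "a k = 0"
proof -
  have "a k = 0 \<and> a (Suc k) = 0"
  proof (rule invariant_imp_always[where P = "\<lambda>x y. x = 0 \<and> y = 0" and n = n])
    fix k assume "a k = 0 \<and> a (Suc k) = 0"
    with rec_lower[of k] rec_upper[of k]
    show "a (Suc k) = 0 \<and> a (Suc (Suc k)) = 0" by auto
  qed (use assms in auto)
  then show ?thesis ..
qed

section \<open>Bounds on the mean value\<close>

text \<open>The shifted sums over a period agree, so the residuals, each in [0, 1), sum to
  \<open>1 + r0 + r1\<close> times the sum of \<open>a\<close>.\<close>

lemma period_sum_bounds:
  shows "0 \<le> (1 + r0 + r1) * (\<Sum>i<p. a i)" and "(1 + r0 + r1) * (\<Sum>i<p. a i) < p"
proof -
  define e where "e i = a (Suc (Suc i)) + r1 * a (Suc i) + r0 * a i" for i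
  have shift: "(\<Sum>i<p. f (Suc i)) = (\<Sum>i<p. f i)" if "f p = f 0" for f :: "nat \<Rightarrow> real"
    using sum.lessThan_Suc_shift[of f p] that by simp
  have "(\<Sum>i<p. real_of_int (a (Suc (Suc i)))) = (\<Sum>i<p. real_of_int (a (Suc i)))"
    using shift[of "\<lambda>i. a (Suc i)"] per[of "Suc 0"] by simp
  moreover have "(\<Sum>i<p. real_of_int (a (Suc i))) = (\<Sum>i<p. real_of_int (a i))"
    using shift[of a] per[of 0] by simp
  ultimately have "(\<Sum>i<p. e i) = (1 + r0 + r1) * (\<Sum>i<p. a i)"
    by (simp add: e_def sum.distrib sum_distrib_left[symmetric] algebra_simps)
  moreover have "0 \<le> (\<Sum>i<p. e i)"
    by (intro sum_nonneg) (simp add: e_def rec_lower)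
  moreover have "(\<Sum>i<p. e i) < (\<Sum>i<p. 1)"
    using p_pos by (intro sum_strict_mono) (auto simp: e_def rec_upper)
  ultimately show "0 \<le> (1 + r0 + r1) * (\<Sum>i<p. a i)" "(1 + r0 + r1) * (\<Sum>i<p. a i) < p"
    by simp_all
qed

lemma not_all_pos:
  assumes "0 \<le> r0 + r1" "\<And>k. a k \<ge> 1"
  shows False
proof -
  have "int p \<le> (\<Sum>i<p. a i)"
    using sum_mono[of "{..<p}" "\<lambda>_. 1" a] assms by simp
  then have "real p \<le> (\<Sum>i<p. a i)" by linarith
  also have "\<dots> \<le> (1 + r0 + r1) * (\<Sum>i<p. a i)"
    using assms(1) \<open>int p \<le> (\<Sum>i<p. a i)\<close>
      mult_right_mono[of 1 "1 + r0 + r1" "real_of_int (\<Sum>i<p. a i)"] by linarith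
  finally show False using period_sum_bounds(2) by simp
qed

text \<open>For \<open>r0 + r1\<close> nonnegative the product in \<open>period_sum_bounds\<close>
  would be negative; for \<open>r0 + r1\<close> at most -2 it would be at least
  \<open>p\<close>.\<close>

lemma not_all_neg:
  assumes "0 \<le> r0 + r1 \<or> r0 + r1 \<le> -2" "\<And>k. a k \<le> -1"
  shows False
proof -
  have "(\<Sum>i<p. a i) \<le> - int p"
    using sum_mono[of "{..<p}" a "\<lambda>_. -1"] assms by simp
  then have le: "real_of_int (\<Sum>i<p. a i) \<le> - real p" by linarith
  from assms(1) show False
  proof
    assume "0 \<le> r0 + r1"
    then have "(1 + r0 + r1) * (\<Sum>i<p. a i) < 0"
      using le p_pos by (intro mult_pos_neg) auto
    then show False using period_sum_bounds(1) by simp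
  next
    assume "r0 + r1 \<le> -2"
    then have "1 * real p \<le> (- (1 + r0 + r1)) * (- (\<Sum>i<p. a i))"
      using le by (intro mult_mono) auto
    also have "\<dots> = (1 + r0 + r1) * (\<Sum>i<p. a i)"
      by (simp only: of_int_minus minus_mult_minus)
    finally show False using period_sum_bounds(2) by simp
  qed
qed

text \<open>The factor \<open>1 + r0 + r1\<close> is negative, so the lower bound forces the sum of
  nonnegative terms to vanish.\<close>

lemma zero_if_all_nonneg:
  assumes "r0 + r1 \<le> -2" "\<And>k. a k \<ge> 0"
  shows "a k = 0"
proof -
  have "\<not> real_of_int (\<Sum>i<p. a i) > 0"
    using period_sum_bounds(1) mult_neg_pos[of "1 + r0 + r1" "\<Sum>i<p. a i"] assms(1) by linarith
  moreover have "(\<Sum>i<p. a i) \<ge> 0" using assms by (intro sum_nonneg) auto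
  ultimately have "(\<Sum>i<p. a i) = 0" by linarith
  then have z: "a i = 0" if "i < p" for i
    using that assms(2) by (subst (asm) sum_nonneg_eq_0_iff) auto
  have "a 0 = 0" using z p_pos by simp
  \<comment> \<open>For \<open>p = 1\<close> index 1 lies outside the summed range, and periodicity
    supplies its value.\<close>
  moreover have "a (Suc 0) = 0"
    using z[of "Suc 0"] per[of 0] \<open>a 0 = 0\<close> p_pos by (cases "p = 1") auto
  ultimately show ?thesis by (rule zero_if_two_zeros)
qed

section \<open>Region (i): two real roots above 1\<close>

lemma zero_region_i:
  assumes "r0 > 0" "r1 \<le> - 2 * sqrt r0" "r0 + r1 \<ge> 0"
  shows "a k = 0"
proof -
  have "(2 * sqrt r0)\<^sup>2 \<le> (- r1)\<^sup>2"
    using assms by (intro power_mono) auto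
  then have disc: "4 * r0 \<le> r1\<^sup>2" using assms(1) by (simp add: power_mult_distrib)
  \<comment> \<open>Both sides are compared with \<open>- r1\<close>, which is at most
    \<open>r0\<close>.\<close>
  have "2 * sqrt r0 \<le> sqrt r0 * sqrt r0"
    using assms by auto
  then have "2 \<le> sqrt r0"
    using assms(1) mult_le_cancel_right_pos[of "sqrt r0" 2 "sqrt r0"] by simp
  then have r1: "r1 \<le> -4" using assms(2) by linarith
  define l m where "l = (- r1 + sqrt (r1\<^sup>2 - 4 * r0)) / 2"
    and "m = (- r1 - sqrt (r1\<^sup>2 - 4 * r0)) / 2"
  have lm_add: "l + m = - r1" by (simp add: l_def m_def field_simps)
  have "l * m = ((- r1)\<^sup>2 - (sqrt (r1\<^sup>2 - 4 * r0))\<^sup>2) / 4"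
    by (simp add: l_def m_def power2_eq_square algebra_simps)
  then have lm_mult: "l * m = r0" using disc by simp
  \<comment> \<open>The left side is the characteristic polynomial at 1, that is
    \<open>1 + r0 + r1\<close>.\<close>
  have prod: "(l - 1) * (m - 1) \<ge> 1"
    using lm_add lm_mult assms(3) by (simp add: algebra_simps)
  have "m \<le> l" using disc by (simp add: l_def m_def field_simps)
  with lm_add r1 have "l > 1" by linarith
  have "m > 1"
    using prod \<open>l > 1\<close> zero_less_mult_pos[of "l - 1" "m - 1"] by simp

  define b where "b n = a (Suc n) - m * a n" for n
  \<comment> \<open>The second-order relation splits into two first-order ones, with ratio
    \<open>l\<close> for \<open>b\<close> and ratio \<open>m\<close> for \<open>a\<close>.\<close>
  have e: "b (Suc n) - l * b n = a (Suc (Suc n)) + r1 * a (Suc n) + r0 * a n" for n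
    unfolding b_def lm_mult[symmetric] using lm_add by (simp add: algebra_simps) algebra
  have bper: "b (n + p) = b n" for n
    using per[of n] per[of "Suc n"] by (simp add: b_def)
  \<comment> \<open>Comparing an extremum of \<open>b\<close> with its successor confines
    \<open>b\<close> to values above \<open>-1 / (l - 1)\<close> and at most 0.\<close>
  obtain i where i: "\<And>k. b k \<le> b (Suc i)"
    using periodic_attains_max[of p b] p_pos bper by auto
  have "(l - 1) * b (Suc i) \<le> 0"
    using e[of "Suc i"] rec_lower[of "Suc i"] i[of "Suc (Suc i)"] by (simp add: algebra_simps)
  then have b_le: "b n \<le> 0" for n
    using i[of n] \<open>l > 1\<close> by (auto simp: mult_le_0_iff)
  obtain j where j: "\<And>k. b (Suc j) \<le> b k"
    using periodic_attains_min[of p b] p_pos bper by auto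
  have "(l - 1) * b (Suc j) > -1"
    using e[of "Suc j"] rec_upper[of "Suc j"] j[of "Suc (Suc j)"] by (simp add: algebra_simps)
  moreover have "(l - 1) * b (Suc j) \<le> (l - 1) * b n" for n
    using j \<open>l > 1\<close> by (intro mult_left_mono) auto
  ultimately have b_gt: "(l - 1) * b n > -1" for n
    by (meson less_le_trans)

  \<comment> \<open>The same comparison for \<open>a (Suc n) - m * a n = b n\<close>: the minimum
    gives nonnegativity, the maximum a bound below 1.\<close>
  obtain j where j: "\<And>k. a (Suc j) \<le> a k" using min_exists by blast
  have "real_of_int (a (Suc j)) \<le> a (Suc (Suc j))" using j by simp
  then have "0 \<le> (m - 1) * a (Suc j)"
    using b_le[of "Suc j"] unfolding b_def by (simp add: algebra_simps)
  then have "0 \<le> a k" for k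
    using j[of k] \<open>m > 1\<close> by (auto simp: zero_le_mult_iff)
  moreover have "a k < 1" for k
  proof -
    obtain i where i: "\<And>k. a k \<le> a (Suc i)" using max_exists by blast
    have "real_of_int (a (Suc (Suc i))) \<le> a (Suc i)" using i by simp
    then have "(m - 1) * a (Suc i) \<le> - b (Suc i)"
      unfolding b_def by (simp add: algebra_simps)
    then have "(l - 1) * ((m - 1) * a (Suc i)) \<le> (l - 1) * (- b (Suc i))"
      using \<open>l > 1\<close> by (intro mult_left_mono) auto
    then have "((l - 1) * (m - 1)) * a (Suc i) < 1"
      using b_gt[of "Suc i"] by (simp add: mult.assoc)
    moreover have "1 * real_of_int (a (Suc i)) \<le> ((l - 1) * (m - 1)) * a (Suc i)"
      using prod \<open>\<And>k. 0 \<le> a k\<close> by (intro mult_right_mono) auto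
    ultimately have "a (Suc i) < 1" by linarith
    then show ?thesis using i[of k] by simp
  qed
  ultimately show ?thesis by (smt (verit))
qed

section \<open>Region (ii) with one dominant coefficient\<close>

text \<open>The maximum is at most 0, and the minimum exceeds \<open>-1 / c\<close>, hence -1, so it
  is nonnegative by integrality.\<close>

lemma zero_if_dominant:
  fixes c :: real
  assumes "c \<ge> 1"
    and "\<And>n. (\<And>k. a k \<le> a (Suc n)) \<Longrightarrow> c * a (Suc n) \<le> 0"
    and "\<And>n. (\<And>k. a (Suc n) \<le> a k) \<Longrightarrow> c * a (Suc n) > -1"
  shows "a k = 0"
proof -
  obtain i where i: "\<And>k. a k \<le> a (Suc i)" using max_exists by blast
  have "a (Suc i) \<le> 0"
    using assms(2)[OF i] \<open>c \<ge> 1\<close> by (simp add: mult_le_0_iff)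
  moreover obtain j where j: "\<And>k. a (Suc j) \<le> a k" using min_exists by blast
  have "\<not> a (Suc j) \<le> -1"
  proof
    assume "a (Suc j) \<le> -1"
    then have "1 * 1 \<le> c * (- a (Suc j))"
      using \<open>c \<ge> 1\<close> by (intro mult_mono) auto
    then show False using assms(3)[OF j] by simp
  qed
  ultimately show ?thesis using i[of k] j[of k] by linarith
qed

text \<open>Since \<open>- r1\<close> is at least \<open>2 + r0\<close>, the middle term dominates,
  and the extremum is placed there.\<close>

lemma zero_region_ii_r0_nonneg:
  assumes "r0 + r1 \<le> -2" "r0 \<ge> 0"
  shows "a k = 0"
proof (rule zero_if_dominant[of "- (1 + r0 + r1)"])
  fix n assume "\<And>k. a k \<le> a (Suc n)"
  then have "real_of_int (a (Suc (Suc n))) \<le> a (Suc n)" "r0 * a n \<le> r0 * a (Suc n)"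
    using \<open>r0 \<ge> 0\<close> by (auto intro: mult_left_mono)
  then show "- (1 + r0 + r1) * a (Suc n) \<le> 0"
    using rec_lower[of n] by (simp add: algebra_simps)
next
  fix n assume "\<And>k. a (Suc n) \<le> a k"
  then have "a (Suc n) \<le> real_of_int (a (Suc (Suc n)))" "r0 * a (Suc n) \<le> r0 * a n"
    using \<open>r0 \<ge> 0\<close> by (auto intro: mult_left_mono)
  then show "- (1 + r0 + r1) * a (Suc n) > -1"
    using rec_upper[of n] by (simp add: algebra_simps)
qed (use assms in simp)

text \<open>Since \<open>- r0\<close> is at least \<open>2 + r1\<close>, the relation is used one
  step later, with the extremum as its oldest term.\<close>

lemma zero_region_ii_r1_nonneg:
  assumes "r0 + r1 \<le> -2" "r1 \<ge> 0"
  shows "a k = 0"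
proof (rule zero_if_dominant[of "- (1 + r0 + r1)"])
  fix n assume "\<And>k. a k \<le> a (Suc n)"
  then have "real_of_int (a (Suc (Suc (Suc n)))) \<le> a (Suc n)"
    "r1 * a (Suc (Suc n)) \<le> r1 * a (Suc n)"
    using \<open>r1 \<ge> 0\<close> by (auto intro: mult_left_mono)
  then show "- (1 + r0 + r1) * a (Suc n) \<le> 0"
    using rec_lower[of "Suc n"] by (simp add: algebra_simps)
next
  fix n assume "\<And>k. a (Suc n) \<le> a k"
  then have "a (Suc n) \<le> real_of_int (a (Suc (Suc (Suc n))))"
    "r1 * a (Suc n) \<le> r1 * a (Suc (Suc n))"
    using \<open>r1 \<ge> 0\<close> by (auto intro: mult_left_mono)
  then show "- (1 + r0 + r1) * a (Suc n) > -1"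
    using rec_upper[of "Suc n"] by (simp add: algebra_simps)
qed (use assms in simp)

section \<open>Region (ii) with both coefficients negative\<close>

lemma zero_if_two_nonneg:
  assumes "r0 + r1 \<le> -2" "r0 < 0" "r1 < 0" "a n \<ge> 0" "a (Suc n) \<ge> 0"
  shows "a k = 0"
proof (rule zero_if_all_nonneg)
  fix k
  have "0 \<le> a k \<and> 0 \<le> a (Suc k)"
  proof (rule invariant_imp_always[where P = "\<lambda>x y. 0 \<le> x \<and> 0 \<le> y" and n = n])
    fix k assume "0 \<le> a k \<and> 0 \<le> a (Suc k)"
    then have "r1 * a (Suc k) \<le> 0" "r0 * a k \<le> 0"
      using assms by (auto simp: mult_le_0_iff)
    then show "0 \<le> a (Suc k) \<and> 0 \<le> a (Suc (Suc k))"
      using rec_lower[of k] \<open>0 \<le> a k \<and> 0 \<le> a (Suc k)\<close> by linarith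
  qed (use assms in auto)
  then show "0 \<le> a k" ..
qed fact

text \<open>Nonpositivity propagates by integrality. If \<open>r0\<close> is at most -2, a negative
  minimum would at least double two steps later; if \<open>r1\<close> is at most -1, a negative term
  spreads over the whole orbit, against the mean value.\<close>

lemma zero_if_two_nonpos:
  assumes "r0 + r1 \<le> -2" "r0 < 0" "r1 < 0" "r0 \<le> -2 \<or> r1 \<le> -1" "a n \<le> 0" "a (Suc n) \<le> 0"
  shows "a k = 0"
proof -
  have np: "a k \<le> 0 \<and> a (Suc k) \<le> 0" for k
  proof (rule invariant_imp_always[where P = "\<lambda>x y. x \<le> 0 \<and> y \<le> 0" and n = n])
    fix k assume *: "a k \<le> 0 \<and> a (Suc k) \<le> 0"
    then have "r1 * a (Suc k) \<ge> 0" "r0 * a k \<ge> 0"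
      using assms by (auto simp: zero_le_mult_iff)
    then show "a (Suc k) \<le> 0 \<and> a (Suc (Suc k)) \<le> 0"
      using rec_upper[of k] * by linarith
  qed (use assms in auto)
  from assms(4) show ?thesis
  proof
    assume "r0 \<le> -2"
    obtain j where j: "\<And>k. a (Suc j) \<le> a k" using min_exists by blast
    have "r1 * a (Suc (Suc j)) \<ge> 0"
      using np assms by (auto simp: zero_le_mult_iff)
    moreover have "2 * real_of_int (- a (Suc j)) \<le> (- r0) * (- a (Suc j))"
      using \<open>r0 \<le> -2\<close> np by (intro mult_right_mono) auto
    ultimately have "real_of_int (a (Suc (Suc (Suc j)))) < 2 * a (Suc j) + 1"
      using rec_upper[of "Suc j"] by simp
    then have "a (Suc (Suc (Suc j))) \<le> 2 * a (Suc j)" by linarith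
    then have "a (Suc j) \<ge> 0" using j[of "Suc (Suc (Suc j))"] by linarith
    then show ?thesis using j[of k] np[of k] by linarith
  next
    assume "r1 \<le> -1"
    have "a (Suc i) = 0" for i
    proof (rule ccontr)
      assume "a (Suc i) \<noteq> 0"
      have inv: "a k \<le> 0 \<and> a (Suc k) \<le> -1" for k
      proof (rule invariant_imp_always[where P = "\<lambda>x y. x \<le> 0 \<and> y \<le> -1" and n = i])
        show "a i \<le> 0 \<and> a (Suc i) \<le> -1"
          using np[of i] \<open>a (Suc i) \<noteq> 0\<close> by linarith
      next
        fix k assume *: "a k \<le> 0 \<and> a (Suc k) \<le> -1"
        then have "1 * 1 \<le> (- r1) * (- a (Suc k))"
          using \<open>r1 \<le> -1\<close> by (intro mult_mono) auto
        moreover have "r0 * a k \<ge> 0"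
          using * assms by (auto simp: zero_le_mult_iff)
        ultimately have "real_of_int (a (Suc (Suc k))) < 0"
          using rec_upper[of k] by simp
        then show "a (Suc k) \<le> 0 \<and> a (Suc (Suc k)) \<le> -1" using * by linarith
      qed
      \<comment> \<open>\<open>inv\<close> covers every index but 0, which periodicity adds.\<close>
      have "a k \<le> -1" for k
      proof (rule eventually_imp_always[where P = "\<lambda>x y. x \<le> -1"])
        show "a k \<le> -1" if "1 \<le> k" for k
          using that inv[of "k - 1"] by simp
      qed
      then show False using assms(1) by (intro not_all_neg) auto
    qed
    then show ?thesis by (meson zero_if_two_zeros)
  qed
qed

text \<open>A nonzero orbit alternates in sign, so \<open>d\<close>, the absolute value of
  \<open>a\<close>, satisfies a recurrence whose residual carries the sign of
  \<open>a n\<close>.\<close>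

lemma zero_region_ii_both_neg:
  assumes "r0 + r1 \<le> -2" "r0 - r1 \<noteq> -1" "r0 < 0" "r1 < 0" "r0 \<le> -2 \<or> r1 \<le> -1"
  shows "a k = 0"
proof (rule ccontr)
  assume "a k \<noteq> 0"
  then have not_nn: "\<not> (a n \<ge> 0 \<and> a (Suc n) \<ge> 0)" and not_np: "\<not> (a n \<le> 0 \<and> a (Suc n) \<le> 0)" for n
    using zero_if_two_nonneg[of n k] zero_if_two_nonpos[of n k] assms by auto
  have nz: "a n \<noteq> 0" for n using not_nn[of n] not_np[of n] by linarith
  have alt: "a (Suc n) < 0 \<longleftrightarrow> a n > 0" for n
    using not_nn[of n] not_np[of n] nz[of n] by linarith
  define d where "d n = real_of_int \<bar>a n\<bar>" for n
  have d1: "d n \<ge> 1" for n using nz[of n] by (simp add: d_def)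
  have d_pos: "0 \<le> d (Suc (Suc n)) + (- r1) * d (Suc n) - (- r0) * d n"
    "d (Suc (Suc n)) + (- r1) * d (Suc n) - (- r0) * d n < 1" if "a n > 0" for n
    using that alt[of n] alt[of "Suc n"] nz[of "Suc (Suc n)"] rec_lower[of n] rec_upper[of n]
    by (auto simp: d_def abs_if)
  have d_neg: "-1 < d (Suc (Suc n)) + (- r1) * d (Suc n) - (- r0) * d n"
    "d (Suc (Suc n)) + (- r1) * d (Suc n) - (- r0) * d n \<le> 0" if "a n < 0" for n
    using that alt[of n] alt[of "Suc n"] nz[of "Suc n"] nz[of "Suc (Suc n)"]
      rec_lower[of n] rec_upper[of n]
    by (auto simp: d_def abs_if)
  \<comment> \<open>The line \<open>r0 - r1 = -1\<close> separates the two cases; the disjunction in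
    the hypotheses yields the second bound in each.\<close>
  consider "- r0 > 1 + (- r1)" "- r0 \<ge> 2" | "- r0 < 1 + (- r1)" "- r1 \<ge> 1"
    using assms by linarith
  then show False
  proof cases
    case 1
    obtain i where "\<And>k. \<bar>a k\<bar> \<le> \<bar>a (Suc i)\<bar>" using abs_max_exists by blast
    then have max: "d k \<le> d (Suc i)" for k by (simp only: d_def of_int_le_iff)
    \<comment> \<open>A positive term of maximal absolute value, taken as the oldest term, would
      outweigh the other two.\<close>
    have neg: "a n < 0" if n: "d n = d (Suc i)" for n
    proof (rule ccontr)
      assume "\<not> a n < 0"
      then have "a n > 0" using nz[of n] by linarith
      have "(- r1) * d (Suc n) \<le> (- r1) * d n"
        using max[of "Suc n"] n assms by (intro mult_left_mono) auto
      moreover have "(1 + (- r1)) * d n < (- r0) * d n"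
        using 1 d1[of n] by (intro mult_strict_right_mono) auto
      ultimately show False
        using d_pos(1)[OF \<open>a n > 0\<close>] max[of "Suc (Suc n)"] n by (simp add: algebra_simps)
    qed
    have "a (Suc i) < 0" by (rule neg) simp
    \<comment> \<open>The next term is positive, hence not maximal in absolute value, and
      integrality makes the gap at least 1.\<close>
    have "d (Suc (Suc i)) \<noteq> d (Suc i)"
      using neg[of "Suc (Suc i)"] alt[of "Suc i"] \<open>a (Suc i) < 0\<close> by auto
    then have "d (Suc (Suc i)) < d (Suc i)"
      using max[of "Suc (Suc i)"] by simp
    then have "d (Suc (Suc i)) \<le> d (Suc i) - 1"
      unfolding d_def of_int_less_iff int_less_real_le by linarith
    then have "(- r1) * d (Suc (Suc i)) \<le> (- r1) * (d (Suc i) - 1)"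
      using assms by (intro mult_left_mono) auto
    then have "(- r0 - 1 - (- r1)) * d (Suc i) < 1 - (- r1)"
      using d_neg(1)[OF \<open>a (Suc i) < 0\<close>] max[of "Suc (Suc (Suc i))"] by (simp add: algebra_simps)
    have "(- r0 - 1 - (- r1)) * 1 \<le> (- r0 - 1 - (- r1)) * d (Suc i)"
      using 1 d1[of "Suc i"] by (intro mult_left_mono) auto
    also have "\<dots> < 1 - (- r1)" by fact
    finally show False using 1 by simp
  next
    case 2
    obtain i where "\<And>k. \<bar>a (Suc i)\<bar> \<le> \<bar>a k\<bar>" using abs_min_exists by blast
    then have min: "d (Suc i) \<le> d k" for k by (simp only: d_def of_int_le_iff)
    \<comment> \<open>Dually, a negative term of minimal absolute value would be outweighed by the
      other two.\<close>
    have pos: "a n > 0" if n: "d n = d (Suc i)" for n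
    proof (rule ccontr)
      assume "\<not> a n > 0"
      then have "a n < 0" using nz[of n] by linarith
      have "(- r1) * d n \<le> (- r1) * d (Suc n)"
        using min[of "Suc n"] n assms by (intro mult_left_mono) auto
      moreover have "(- r0) * d n < (1 + (- r1)) * d n"
        using 2 d1[of n] by (intro mult_strict_right_mono) auto
      ultimately show False
        using d_neg(2)[OF \<open>a n < 0\<close>] min[of "Suc (Suc n)"] n by (simp add: algebra_simps)
    qed
    have "a (Suc i) > 0" by (rule pos) simp
    have "d (Suc (Suc i)) \<noteq> d (Suc i)"
      using pos[of "Suc (Suc i)"] alt[of "Suc i"] \<open>a (Suc i) > 0\<close> by auto
    then have "d (Suc i) < d (Suc (Suc i))"
      using min[of "Suc (Suc i)"] by simp
    then have "d (Suc i) + 1 \<le> d (Suc (Suc i))"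
      unfolding d_def of_int_less_iff int_less_real_le by linarith
    then have "(- r1) * (d (Suc i) + 1) \<le> (- r1) * d (Suc (Suc i))"
      using assms by (intro mult_left_mono) auto
    moreover have "(- r0) * d (Suc i) < (1 + (- r1)) * d (Suc i)"
      using 2 d1[of "Suc i"] by (intro mult_strict_right_mono) auto
    ultimately show False
      using d_pos(2)[OF \<open>a (Suc i) > 0\<close>] min[of "Suc (Suc (Suc i))"] 2
      by (simp add: algebra_simps)
  qed
qed

section \<open>Region (iii)\<close>

text \<open>A sign change, with 0 allowed as the earlier value, repeats forever. From then on
  absolute values never decrease, and they grow strictly at each step from a negative to a positive
  term, so no maximum exists.\<close>

lemma no_sign_change_region_iii:
  assumes "r0 < 0" "r1 \<ge> 1" "a n \<le> 0 \<and> a (Suc n) \<ge> 1 \<or> a n \<ge> 0 \<and> a (Suc n) \<le> -1"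
  shows False
proof -
  have next_neg: "a (Suc (Suc k)) \<le> - a (Suc k)" if "a k \<le> 0" "a (Suc k) \<ge> 1" for k
  proof -
    have "r0 * a k \<ge> 0" using that assms by (auto simp: zero_le_mult_iff)
    moreover have "1 * real_of_int (a (Suc k)) \<le> r1 * a (Suc k)"
      using that assms by (intro mult_right_mono) auto
    ultimately show ?thesis using rec_upper[of k] by linarith
  qed
  have next_pos: "a (Suc (Suc k)) \<ge> - a (Suc k) - r0 * a k" if "a k \<ge> 0" "a (Suc k) \<le> -1" for k
  proof -
    have "r1 * a (Suc k) \<le> 1 * real_of_int (a (Suc k))"
      using that assms by (intro mult_right_mono_neg) auto
    then show ?thesis using rec_lower[of k] by linarith
  qed
  have next_pos': "a (Suc (Suc k)) \<ge> - a (Suc k)" if "a k \<ge> 0" "a (Suc k) \<le> -1" for k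
  proof -
    have "r0 * a k \<le> 0" using that assms by (auto simp: mult_le_0_iff)
    then show ?thesis using next_pos[OF that] by linarith
  qed
  have opp: "a k \<le> 0 \<and> a (Suc k) \<ge> 1 \<or> a k \<ge> 0 \<and> a (Suc k) \<le> -1" for k
  proof (rule invariant_imp_always[where n = n
        and P = "\<lambda>x y. x \<le> 0 \<and> y \<ge> 1 \<or> x \<ge> 0 \<and> y \<le> -1"])
    fix k assume "a k \<le> 0 \<and> a (Suc k) \<ge> 1 \<or> a k \<ge> 0 \<and> a (Suc k) \<le> -1"
    then show "a (Suc k) \<le> 0 \<and> a (Suc (Suc k)) \<ge> 1 \<or> a (Suc k) \<ge> 0 \<and> a (Suc (Suc k)) \<le> -1"
      using next_neg[of k] next_pos'[of k] by linarith
  qed (use assms in auto)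
  have nz: "a k \<noteq> 0" for k
  proof (rule eventually_imp_always[where P = "\<lambda>x y. x \<noteq> 0"])
    show "a k \<noteq> 0" if "1 \<le> k" for k
      using that opp[of "k - 1"] by auto
  qed
  obtain i where max: "\<And>k. \<bar>a k\<bar> \<le> \<bar>a (Suc i)\<bar>" using abs_max_exists by blast
  \<comment> \<open>Strictness comes from \<open>r0 * a j < 0\<close>: the successor of such a term
    has larger absolute value.\<close>
  have no_max: False if "a (Suc j) \<le> -1" "a (Suc j) = - \<bar>a (Suc i)\<bar>" "a j \<ge> 1" for j
  proof -
    have "r0 * a j < 0" using that assms by (auto simp: mult_less_0_iff)
    then have "a (Suc (Suc j)) > - a (Suc j)"
      using next_pos[of j] that by linarith
    then show False using max[of "Suc (Suc j)"] that by linarith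
  qed
  show False
  proof (cases "a (Suc i) \<ge> 1")
    case False
    then have "a (Suc i) \<le> -1" using opp[of i] by linarith
    moreover have "a i \<ge> 1" using calculation opp[of i] nz[of i] by linarith
    ultimately show False using no_max[of i] by linarith
  next
    case True
    \<comment> \<open>A positive maximum passes its absolute value on to its negative successor,
      where \<open>no_max\<close> applies.\<close>
    then have "a (Suc (Suc i)) \<le> - a (Suc i)" using next_neg[of i] opp[of i] by linarith
    then have "a (Suc (Suc i)) = - \<bar>a (Suc i)\<bar>" using max[of "Suc (Suc i)"] True by linarith
    then show False using no_max[of "Suc i"] True by linarith
  qed
qed

text \<open>Without sign changes a nonzero orbit has one strict sign throughout, which the mean
  value excludes.\<close>

lemma zero_region_iii:
  assumes "r0 + r1 \<ge> 0" "r0 < 0" "r1 \<ge> 1"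
  shows "a k = 0"
proof (rule ccontr)
  assume k: "a k \<noteq> 0"
  have nn: "a (Suc n) \<ge> 0" if "a n \<ge> 0" for n
    using no_sign_change_region_iii[of n] assms that by force
  have np: "a (Suc n) \<le> 0" if "a n \<le> 0" for n
    using no_sign_change_region_iii[of n] assms that by force
  have nz: "a n \<noteq> 0" for n
  proof
    assume "a n = 0"
    then have "a (Suc n) = 0" using nn[of n] np[of n] by linarith
    then show False using zero_if_two_zeros[OF \<open>a n = 0\<close>] k by blast
  qed
  show False
  proof (cases "a 0 \<ge> 0")
    case True
    then have "a n \<ge> 0" for n by (induction n) (auto intro: nn)
    then have "a n \<ge> 1" for n using nz[of n] by (smt (verit))
    then show False using assms(1) by (rule not_all_pos[rotated])
  next
    case False
    then have "a n \<le> 0" for n by (induction n) (auto intro: np)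
    then have "a n \<le> -1" for n using nz[of n] by (smt (verit))
    then show False using assms(1) by (intro not_all_neg) auto
  qed
qed

end

section \<open>Membership in \<open>D2_star\<close> for the three regions\<close>

theorem theorem3:
  fixes r :: "real \<times> real"
  assumes "r \<in> {(r0, r1). r0 > 0 \<and> r1 \<le> - 2 * sqrt r0 \<and> r0 + r1 \<ge> 0}
         \<or> r \<in> {(r0, r1). r0 + r1 \<le> - 2 \<and> r0 - r1 \<noteq> - 1} - {(r0, r1). r0 > - 2 \<and> r1 > - 1}
         \<or> r \<in> {(r0, r1). r0 + r1 \<ge> 0 \<and> r0 < 0 \<and> r1 \<ge> 1}"
  shows "r \<in> D2_star"
proof -
  obtain r0 r1 where r: "r = (r0, r1)" by (cases r)
  have "ends_in_trivial_cycle (srs_orbit r x)" if up: "ultimately_periodic (srs_orbit r x)" for x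
  proof -
    obtain n0 p where p: "p > 0" "\<And>n. n \<ge> n0 \<Longrightarrow> srs_orbit r x (n + p) = srs_orbit r x n"
      using up unfolding ultimately_periodic_def by blast
    define a where "a n = srs_orbit r x (n0 + n)" for n
    have rec: "a (Suc (Suc n)) = - \<lfloor>r0 * a n + r1 * a (Suc n)\<rfloor>" for n
      using srs_orbit_rec[of r x "n0 + n"] by (simp add: a_def r)
    interpret periodic_srs r0 r1 a p
    proof
      show "a (n + p) = a n" for n
        using p(2)[of "n0 + n"] by (simp add: a_def add.assoc)
      show "0 \<le> a (Suc (Suc n)) + r1 * a (Suc n) + r0 * a n"
        and "a (Suc (Suc n)) + r1 * a (Suc n) + r0 * a n < 1" for n
        unfolding rec by linarith+
    qed (use p in simp)
    \<comment> \<open>Region (ii) is split by the signs of \<open>r0\<close> and \<open>r1\<close>;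
      when both are negative, removing the excluded set leaves \<open>r0 \<le> -2\<close> or
      \<open>r1 \<le> -1\<close>.\<close>
    have "a k = 0" for k
      using assms zero_region_i[of k] zero_region_ii_r0_nonneg[of k] zero_region_ii_r1_nonneg[of k]
        zero_region_ii_both_neg[of k] zero_region_iii[of k]
      by (auto simp: r not_less) (meson not_le)+
    then have "\<forall>n\<ge>n0. srs_orbit r x n = 0"
      unfolding a_def by (metis le_add_diff_inverse)
    then show ?thesis
      unfolding ends_in_trivial_cycle_def by blast
  qed
  then show ?thesis
    by (simp add: D2_star_def)
qed

end
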